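(* (Supergraph Theorem) Let $N$ be a $2p\times 2p$ real positive definite matrix having the SSSP, with labeled graph $G^L$. Let $H^L$ be a labeled graph on the vertex set $\{1,\dots,2p\}$ obtained from $G^L$ by inserting some edges. Then there exists a positive definite matrix with labeled graph $H^L$ that has the same symplectic eigenvalues (with multiplicities) as $N$ and that also has the SSSP.
   Context: $\Omega=\begin{bmatrix}O&I_p\\ -I_p&O\end{bmatrix}$; a real $2p\times2p$ matrix $S$ is symplectic if $S^\top\Omega S=\Omega$. Positive definite matrices are real symmetric. By Williamson's theorem, for each $2p\times 2p$ positive definite $N$ there is a symplectic $S$ with $S^\top NS=D\oplus D$, $D$ a $p\times p$ diagonal matrix whose diagonal entries are positive and unique up to order; these are the symplectic eigenvalues of $N$ (a multiset of size $p$). Labeled graphs of order $2p$ are simple graphs on vertex set $\{1,\dots,2p\}$. The labeled graph $\mathcal G^L(N)$ of a positive definite $N=[n_{ij}]$ has edges $\{ij: i\ne j,\ n_{ij}\neq0\}$. For a labeled graph $G^L$, $\mathcal S(G^L)$ is the set of real symmetric matrices $A=[a_{ij}]$ such that for $i\ne j$, $a_{ij}\ne0$ if and only if $ij$ is an edge of $G^L$ (diagonal entries arbitrary). $\mathfrak{sp}(2p)$ is the space of Hamiltonian matrices $\begin{bmatrix}R&E\\ F&-R^\top\end{bmatrix}$ with $R,E,F$ real $p\times p$ and $E,F$ symmetric. $\mathrm{Symm}(2p)$ is the space of real symmetric $2p\times2p$ matrices. A positive definite $2p\times 2p$ matrix $N$ has the Strong Symplectic Spectral Property (SSSP) if $$\{NM+M^\top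 N: M\in\mathfrak{sp}(2p)\}+\operatorname{Span}\mathcal S(\mathcal G^L(N))=\mathrm{Symm}(2p).$$ *)

theory Defs
  imports "HOL-Analysis.Analysis" "HOL-Library.Multiset" "HOL-Library.Set_Algebras"
begin

text \<open>
  Matrices of order \<open>2p\<close> are indexed by \<open>'p + 'p\<close>, where \<open>p = CARD('p)\<close>: the
  elements \<open>Inl a\<close> play the role of the labels \<open>1, \<dots>, p\<close>, and the elements \<open>Inr a\<close>,
  in the same order, that of \<open>p + 1, \<dots>, 2p\<close>.
\<close>

type_synonym 'p mat2 = "real ^ ('p + 'p) ^ ('p + 'p)"

definition block ::
  "real ^ 'p ^ 'p \<Rightarrow> real ^ 'p ^ 'p \<Rightarrow> real ^ 'p ^ 'p \<Rightarrow> real ^ 'p ^ 'p \<Rightarrow> ('p::finite) mat2"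
  where
  "block A B C D = (\<chi> i j.
     case i of
       Inl a \<Rightarrow> (case j of Inl b \<Rightarrow> A $ a $ b | Inr b \<Rightarrow> B $ a $ b)
     | Inr a \<Rightarrow> (case j of Inl b \<Rightarrow> C $ a $ b | Inr b \<Rightarrow> D $ a $ b))"

definition diag :: "('p \<Rightarrow> real) \<Rightarrow> real ^ 'p ^ ('p::finite)" where
  "diag d = (\<chi> i j. if i = j then d i else 0)"

definition symm :: "(real ^ 'n ^ 'n) set" where
  "symm = {A. transpose A = A}"

definition pos_def :: "real ^ 'n ^ ('n::finite) \<Rightarrow> bool" where
  "pos_def A \<longleftrightarrow> A \<in> symm \<and> (\<forall>x. x \<noteq> 0 \<longrightarrow> x \<bullet> (A *v x) > 0)"

definition Omega :: "('p::finite) mat2" where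
  "Omega = block 0 (mat 1) (- mat 1) 0"

definition symplectic :: "('p::finite) mat2 \<Rightarrow> bool" where
  "symplectic S \<longleftrightarrow> transpose S ** Omega ** S = Omega"

text \<open>
  For positive definite \<open>N\<close>, Williamson's theorem says that there is exactly one
  multiset as described below; for other matrices the value is irrelevant.
\<close>

definition symplectic_eigenvalues :: "('p::finite) mat2 \<Rightarrow> real multiset" where
  "symplectic_eigenvalues N = (THE X. \<exists>S d.
     symplectic S \<and> (\<forall>i. d i > 0) \<and>
     transpose S ** N ** S = block (diag d) 0 0 (diag d) \<and>
     X = image_mset d (mset_set UNIV))"

text \<open>
  A labeled graph whose vertex set is the whole (finite) type \<open>'v\<close> is given by its
  set of edges.
\<close>

definition labeled_graph :: "'v set set \<Rightarrow> bool" where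
  "labeled_graph E \<longleftrightarrow> (\<forall>e\<in>E. card e = 2)"

definition graph_of :: "real ^ 'n ^ 'n \<Rightarrow> 'n set set" where
  "graph_of N = {{i, j} | i j. i \<noteq> j \<and> N $ i $ j \<noteq> 0}"

definition graph_matrices :: "'n set set \<Rightarrow> (real ^ 'n ^ 'n) set" where
  "graph_matrices E = {A \<in> symm. \<forall>i j. i \<noteq> j \<longrightarrow> (A $ i $ j \<noteq> 0 \<longleftrightarrow> {i, j} \<in> E)}"

definition hamiltonian :: "('p::finite) mat2 set" where
  "hamiltonian = {block R E F (- transpose R) | R E F. E \<in> symm \<and> F \<in> symm}"

definition SSSP :: "('p::finite) mat2 \<Rightarrow> bool" where
  "SSSP N \<longleftrightarrow>
     {N ** M + transpose M ** N | M. M \<in> hamiltonian} + span (graph_matrices (graph_of N)) = symm"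

end

theory Submission imports Defs begin

text \<open>
  A congruence \<open>S\<^sup>T N S\<close> by a symplectic \<open>S\<close> is positive definite and has the symplectic
  eigenvalues of \<open>N\<close>. So the task is to move \<open>N\<close> inside its symplectic congruence class to a
  matrix \<open>N + t X + B\<close>, where \<open>X\<close> is the 0-1 matrix of the edges to be inserted, \<open>t > 0\<close> is
  small, and \<open>B\<close> is a small symmetric matrix supported on the diagonal and the edges of the
  graph \<open>G\<close> of \<open>N\<close>. Such a matrix is \<open>t \<noteq> 0\<close> at the new edges, is zero at the non-edges of \<open>H\<close>,
  and is still nonzero at the old edges because \<open>t X + B\<close> is small.

  The tangent space at \<open>N\<close> to the congruence class is \<open>{N M + M\<^sup>T N}\<close>, with \<open>M\<close>
  Hamiltonian. The SSSP says that this space and the admissible \<open>B\<close> together span all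
  symmetric matrices, so an open mapping argument provides a congruence and a \<open>B\<close> for every
  small \<open>t X\<close>. To avoid matrix exponentials and inverses, \<open>S\<close> is the Cayley
  transform \<open>(1 + M) (1 - M)\<^sup>-\<^sup>1\<close> of a Hamiltonian \<open>M\<close>; then \<open>N' = S\<^sup>T N S\<close> becomes the
  polynomial equation
  \<open>(1 + M)\<^sup>T N (1 + M) = (1 - M)\<^sup>T N' (1 - M)\<close>.
  It is solved in \<open>cayley_equation_solvable\<close> and turned back into a symplectic congruence in
  \<open>cayley_transform\<close>.

  The new matrix inherits the SSSP because surjectivity of a linear map between
  finite-dimensional spaces survives small perturbations
  (\<open>surjective_under_perturbation\<close>), and because inserting edges only enlarges the span of
  the matrices of the graph.

  Sussmann's open mapping theorem concerns maps onto a whole Euclidean space, whereas the SSSP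
  is about symmetric matrices. The admissible matrices \<open>B\<close> are therefore enlarged by all
  skew-symmetric ones (\<open>edge_part\<close>); in the solution the skew part vanishes, because all
  other terms are symmetric.
\<close>

section \<open>Linear algebra of matrix products\<close>

lemma matrix_add_rdistrib: "(A + B) ** C = A ** C + B ** (C :: real^'k^'n)"
  for A B :: "real^'n^'m"
  by (simp add: vec_eq_iff matrix_matrix_mult_def distrib_right sum.distrib)

interpretation matrix_mult: bounded_bilinear
  "(**) :: real^'n^'m \<Rightarrow> real^'k^'n \<Rightarrow> real^'k^'m"
  unfolding bilinear_conv_bounded_bilinear[symmetric] bilinear_def
  by (auto intro!: linearI simp: matrix_add_ldistrib matrix_add_rdistrib matrix_scalar_ac
      scalar_matrix_assoc)

lemma bounded_linear_transpose: "bounded_linear (transpose :: real^'n^'m \<Rightarrow> real^'m^'n)"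
  unfolding linear_conv_bounded_linear[symmetric]
  by (auto intro!: linearI simp: transpose_def vec_eq_iff)

lemmas transpose_linear =
  linear_add[OF bounded_linear.linear[OF bounded_linear_transpose]]
  linear_diff[OF bounded_linear.linear[OF bounded_linear_transpose]]
  linear_neg[OF bounded_linear.linear[OF bounded_linear_transpose]]
  linear_cmul[OF bounded_linear.linear[OF bounded_linear_transpose]]
  linear_0[OF bounded_linear.linear[OF bounded_linear_transpose]]

lemmas matrix_algebra =
  matrix_mult.add_left matrix_mult.add_right matrix_mult.diff_left matrix_mult.diff_right
  matrix_mult.minus_left matrix_mult.minus_right matrix_mult.scaleR_left matrix_mult.scaleR_right
  matrix_mult.zero_left matrix_mult.zero_right transpose_linear
  matrix_transpose_mul matrix_mul_assoc

section \<open>Solving the Cayley equation and perturbing surjectivity\<close>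

text \<open>
  The difference of the two sides vanishes at \<open>z = 0\<close>, \<open>b = 0\<close>, \<open>Y = 0\<close>, where its
  derivative is \<open>2 (N (h z) + (h z)\<^sup>T N) - q b - Y\<close>. For every prescribed \<open>Y\<close> this is onto by
  hypothesis, so the open mapping theorem applies to the map that also records \<open>Y\<close> as a second
  component: near \<open>(0, 0)\<close> every value \<open>(0, Y)\<close> is attained.
\<close>

lemma cayley_equation_solvable:
  fixes h :: "'a::euclidean_space \<Rightarrow> real^'n^'n" and q :: "'b::euclidean_space \<Rightarrow> real^'n^'n"
  assumes h: "linear h" and q: "linear q" and "e > 0"
    and onto: "\<And>C. \<exists>z b. N ** h z + transpose (h z) ** N + q b = C"
  obtains d where "d > 0"
    and "\<And>Y. norm Y < d \<Longrightarrow> \<exists>z b. norm b < e \<and>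
      transpose (mat 1 + h z) ** N ** (mat 1 + h z) =
      transpose (mat 1 - h z) ** (N + Y + q b) ** (mat 1 - h z)"
proof -
  define f :: "'a \<times> 'b \<times> (real^'n^'n) \<Rightarrow> (real^'n^'n) \<times> (real^'n^'n)" where
    "f v = (transpose (mat 1 + h (fst v)) ** N ** (mat 1 + h (fst v)) -
            transpose (mat 1 - h (fst v)) ** (N + snd (snd v) + q (fst (snd v))) ** (mat 1 - h (fst v)),
            snd (snd v))" for v
  define f' :: "'a \<times> 'b \<times> (real^'n^'n) \<Rightarrow> (real^'n^'n) \<times> (real^'n^'n)" where
    "f' v = (2 *\<^sub>R (N ** h (fst v) + transpose (h (fst v)) ** N) - q (fst (snd v)) - snd (snd v),
            snd (snd v))" for v
  have bl: "bounded_linear h" "bounded_linear q"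
    using h q by (auto simp: linear_conv_bounded_linear)
  have zero: "h 0 = 0" "q 0 = 0"
    using h q by (auto simp: linear_0)
  have cont: "continuous_on UNIV f"
    unfolding f_def
    by (intro continuous_intros matrix_mult.continuous_on bounded_linear.continuous_on[OF bl(1)]
        bounded_linear.continuous_on[OF bounded_linear_transpose] bounded_linear.continuous_on[OF bl(2)])
  have deriv: "(f has_derivative f') (at 0)"
    unfolding f_def
    by (rule has_derivative_eq_rhs, (rule derivative_intros matrix_mult.FDERIV
        bounded_linear.has_derivative[OF bounded_linear_transpose]
        bounded_linear.has_derivative[OF bl(1)] bounded_linear.has_derivative[OF bl(2)])+)
       (auto simp: f'_def fun_eq_iff zero matrix_algebra scaleR_2 algebra_simps)
  have "surj f'"
  proof (rule surjI)
    fix w :: "(real^'n^'n) \<times> (real^'n^'n)"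
    show "f' (SOME v. f' v = w) = w"
    proof (rule someI_ex)
      obtain z b where zb: "N ** h z + transpose (h z) ** N + q b = fst w + snd w"
        using onto by blast
      (* The factor 1/2 absorbs the 2 in the derivative; q enters f' with a minus sign. *)
      have "f' ((1/2) *\<^sub>R z, - b, snd w) = w"
        using zb h q by (auto simp: f'_def linear_cmul linear_neg matrix_algebra prod_eq_iff
            algebra_simps)
      then show "\<exists>v. f' v = w" ..
    qed
  qed
  moreover have "linear f'"
    using deriv has_derivative_linear by blast
  ultimately obtain g' where g': "linear g'" "f' \<circ> g' = id"
    using linear_surjective_right_inverse by blast
  define T where "T = {v :: 'a \<times> 'b \<times> (real^'n^'n). norm (fst (snd v)) < e}"
  have "open T"
    unfolding T_def by (intro open_Collect_less continuous_intros)
  then have "f 0 \<in> interior (f ` T)"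
    using \<open>e > 0\<close> g'
    by (intro sussmann_open_mapping[OF open_UNIV cont _ deriv, of g'])
       (auto simp: linear_conv_bounded_linear interior_open T_def)
  moreover have "f 0 = 0"
    by (simp add: f_def zero prod_eq_iff)
  ultimately obtain d where d: "d > 0" "ball 0 d \<subseteq> f ` T"
    by (auto simp: mem_interior)
  show thesis
  proof
    fix Y :: "real^'n^'n"
    assume "norm Y < d"
    then have "(0 :: real^'n^'n, Y) \<in> ball 0 d"
      unfolding mem_ball_0 norm_Pair by simp
    then have "(0, Y) \<in> f ` T"
      using d by blast
    then obtain v where "v \<in> T" "f v = (0, Y)"
      by (metis imageE)
    then have "norm (fst (snd v)) < e" and "snd (snd v) = Y"
      and "transpose (mat 1 + h (fst v)) ** N ** (mat 1 + h (fst v)) =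
        transpose (mat 1 - h (fst v)) ** (N + snd (snd v) + q (fst (snd v))) ** (mat 1 - h (fst v))"
      unfolding T_def f_def mem_Collect_eq prod.inject right_minus_eq by blast+
    then show "\<exists>z b. norm b < e \<and>
      transpose (mat 1 + h z) ** N ** (mat 1 + h z) =
      transpose (mat 1 - h z) ** (N + Y + q b) ** (mat 1 - h z)"
      by metis
  qed (fact d)
qed

text \<open>
  Let \<open>R\<close> be a linear right inverse of the map belonging to \<open>N\<close>. Replacing \<open>N\<close> by \<open>N'\<close>
  turns the identity into the identity plus an operator of norm at most \<open>K \<parallel>N' - N\<parallel>\<close>, for
  a constant \<open>K\<close>. If this bound is less than \<open>1\<close>, the sum is injective, hence surjective in finite dimension.
\<close>

lemma surjective_under_perturbation:
  fixes h :: "'a::euclidean_space \<Rightarrow> real^'n^'n" and q :: "'b::euclidean_space \<Rightarrow> real^'n^'n"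
  assumes h: "linear h" and q: "linear q"
    and onto: "\<And>C. \<exists>z b. N ** h z + transpose (h z) ** N + q b = C"
  obtains d where "d > 0"
    and "\<And>N' C. norm (N' - N) < d \<Longrightarrow> \<exists>z b. N' ** h z + transpose (h z) ** N' + q b = C"
proof -
  define L where "L P v = P ** h (fst v) + transpose (h (fst v)) ** P + q (snd v)" for P v
  have lin: "linear (L P)" for P
    unfolding L_def using h q
    by (intro linearI)
       (auto simp: linear_add linear_cmul matrix_algebra algebra_simps)
  have "surj (L N)"
    using onto unfolding surj_def L_def by (metis fst_conv snd_conv)
  then obtain R where R: "linear R" "L N \<circ> R = id"
    using linear_surjective_right_inverse lin by blast
  define D where "D P X = P ** h (fst (R X)) + transpose (h (fst (R X))) ** P" for P X
  have "bilinear D"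
    unfolding bilinear_def D_def using h R(1)
    by (auto intro!: linearI simp: linear_add linear_cmul matrix_algebra algebra_simps)
  then obtain K where K: "K > 0" "\<And>P X. norm (D P X) \<le> norm P * norm X * K"
    using bilinear_conv_bounded_bilinear bounded_bilinear.pos_bounded by blast
  show thesis
  proof
    show "1 / K > 0" using K by simp
    fix N' C :: "real^'n^'n"
    assume small: "norm (N' - N) < 1 / K"
    have split: "L N' (R X) = X + D (N' - N) X" for X
    proof -
      have "L N (R X) = X" using R(2) by (metis comp_apply id_apply)
      then show ?thesis by (auto simp: L_def D_def matrix_algebra algebra_simps)
    qed
    have lin': "linear (L N' \<circ> R)"
      using R(1) lin by (rule linear_compose)
    have "X = 0" if "L N' (R X) = 0" for X
    proof (rule ccontr)
      assume "X \<noteq> 0"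
      have "norm X = norm (D (N' - N) X)"
        using that split[of X] by (metis add_eq_0_iff norm_minus_cancel)
      also have "\<dots> \<le> norm (N' - N) * norm X * K" by (rule K)
      also have "\<dots> < norm X"
        using small \<open>X \<noteq> 0\<close> K(1) by (simp add: field_simps)
      finally show False by simp
    qed
    then have "inj (L N' \<circ> R)"
      using lin' by (simp add: linear_injective_0)
    then have "surj (L N' \<circ> R)"
      using lin' linear_injective_imp_surjective by blast
    then obtain X where "C = (L N' \<circ> R) X"
      by (rule surjE)
    then have "L N' (R X) = C" by simp
    then show "\<exists>z b. N' ** h z + transpose (h z) ** N' + q b = C"
      unfolding L_def by blast
  qed
qed

section \<open>Hamiltonian and symplectic matrices\<close>

lemma Omega_mult_nth [simp]:
  "(Omega ** M) $ Inl a = M $ Inr a" "(Omega ** M) $ Inr a = - (M $ Inl a)"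
  for M :: "('p::finite) mat2"
proof -
  have "(Omega ** M) $ Inl a $ j = M $ Inr a $ j" "(Omega ** M) $ Inr a $ j = - (M $ Inl a $ j)" for j
    by (simp_all add: matrix_matrix_mult_def Omega_def block_def mat_def sum.Plus
        if_distrib[of "\<lambda>x. x * _"] UNIV_Plus_UNIV[symmetric] sum_negf
        cong: if_cong del: UNIV_Plus_UNIV)
  then show "(Omega ** M) $ Inl a = M $ Inr a" "(Omega ** M) $ Inr a = - (M $ Inl a)"
    by (simp_all add: vec_eq_iff)
qed

lemma Omega_square: "Omega ** Omega = - (mat 1 :: ('p::finite) mat2)"
proof -
  have "(Omega ** Omega) $ i $ j = - (mat 1 :: 'p mat2) $ i $ j" for i j
    by (cases i; cases j; simp) (auto simp: Omega_def block_def mat_def)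
  then show ?thesis by (simp add: vec_eq_iff)
qed

lemma transpose_Omega: "transpose Omega = - Omega"
  by (auto simp: vec_eq_iff transpose_def Omega_def block_def mat_def split: sum.splits)

lemma Omega_mult_Omega_mult: "Omega ** (Omega ** M) = - M"
  by (simp add: matrix_mul_assoc Omega_square matrix_algebra)

lemma symm_iff: "A \<in> symm \<longleftrightarrow> (\<forall>i j. A $ i $ j = A $ j $ i)"
  by (auto simp: symm_def vec_eq_iff transpose_def)

lemma hamiltonian_iff: "M \<in> hamiltonian \<longleftrightarrow> Omega ** M \<in> symm"
proof
  assume "M \<in> hamiltonian"
  then obtain R E F where M: "M = block R E F (- transpose R)" and "E \<in> symm" "F \<in> symm"
    by (auto simp: hamiltonian_def)
  then have "(Omega ** M) $ i $ j = (Omega ** M) $ j $ i" for i j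
    by (cases i; cases j) (auto simp: block_def transpose_def symm_iff)
  then show "Omega ** M \<in> symm" by (simp add: symm_iff)
next
  assume "Omega ** M \<in> symm"
  then have sym: "(Omega ** M) $ i $ j = (Omega ** M) $ j $ i" for i j
    by (simp add: symm_iff)
  define R E F where "R = (\<chi> a b. M $ Inl a $ Inl b)" and "E = (\<chi> a b. M $ Inl a $ Inr b)"
    and "F = (\<chi> a b. M $ Inr a $ Inl b)"
  have "M $ i $ j = block R E F (- transpose R) $ i $ j" for i j
    using sym[of "Inl _" "Inr _"]
    by (cases i; cases j) (auto simp: block_def R_def E_def F_def transpose_def)
  moreover have "E \<in> symm" "F \<in> symm"
    using sym[of "Inr _" "Inr _"] sym[of "Inl _" "Inl _"] by (auto simp: symm_iff E_def F_def)
  ultimately show "M \<in> hamiltonian"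
    unfolding hamiltonian_def by (auto simp: vec_eq_iff)
qed

text \<open>
  The open mapping theorem needs a linear parametrization of the Hamiltonian matrices by a
  Euclidean space. As \<open>\<Omega>\<^sup>2 = -1\<close>, they are the matrices \<open>\<Omega> K\<close> with \<open>K\<close> symmetric, and the
  symmetric matrices are the matrices \<open>Z + Z\<^sup>T\<close>.
\<close>

lemma hamiltonian_parametrization:
  "hamiltonian = range (\<lambda>Z. Omega ** (Z + transpose Z))"
proof (intro equalityI subsetI)
  fix M :: "'a mat2" assume "M \<in> hamiltonian"
  then have "Omega ** M = transpose (Omega ** M)"
    by (simp add: hamiltonian_iff symm_def)
  then have "M = Omega ** ((- (1/2)) *\<^sub>R (Omega ** M) + transpose ((- (1/2)) *\<^sub>R (Omega ** M)))"
    by (simp only: transpose_linear)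
       (simp add: matrix_mult.add_right matrix_mult.scaleR_right matrix_mult.minus_right
          Omega_mult_Omega_mult scaleR_left_distrib[symmetric] flip: \<open>Omega ** M = transpose (Omega ** M)\<close>)
  then show "M \<in> range (\<lambda>Z. Omega ** (Z + transpose Z))" by blast
next
  fix M :: "'a mat2" assume "M \<in> range (\<lambda>Z. Omega ** (Z + transpose Z))"
  then obtain Z where "M = Omega ** (Z + transpose Z)" by blast
  then show "M \<in> hamiltonian"
    by (simp add: hamiltonian_iff Omega_mult_Omega_mult symm_def transpose_linear add.commute)
qed


section \<open>Matrices supported on a graph\<close>

text \<open>
  A linear map onto the sums of a skew-symmetric matrix and a symmetric matrix supported on the
  diagonal and the edges of \<open>G\<close>. Off the edges the two entries at \<open>(i, j)\<close> and \<open>(j, i)\<close>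
  are forced to be opposite, and everywhere else the entries are free.
\<close>

definition edge_part :: "'n set set \<Rightarrow> real^'n^'n \<Rightarrow> real^'n^'n" where
  "edge_part G B = (\<chi> i j. if i = j \<or> {i, j} \<in> G then B $ i $ j else B $ i $ j - B $ j $ i)"

lemma linear_edge_part: "linear (edge_part G)"
  by (auto intro!: linearI simp: edge_part_def vec_eq_iff algebra_simps)

text \<open>
  Off the edges \<open>edge_part\<close> is skew-symmetric by construction, so symmetry leaves only zero there.
\<close>

lemma edge_part_symm_eq_0:
  assumes "edge_part G B \<in> symm" "i \<noteq> j" "{i, j} \<notin> G"
  shows "edge_part G B $ i $ j = 0"
proof -
  have "edge_part G B $ i $ j = edge_part G B $ j $ i"
    using assms(1) by (simp add: symm_iff)
  then show ?thesis
    using assms(2,3) by (auto simp: edge_part_def insert_commute)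
qed

lemma range_edge_part:
  assumes "\<And>i j. i \<noteq> j \<Longrightarrow> {i, j} \<notin> G \<Longrightarrow> A $ i $ j + A $ j $ i = 0"
  obtains B where "edge_part G B = A"
proof
  show "edge_part G (\<chi> i j. if i = j \<or> {i, j} \<in> G then A $ i $ j else A $ i $ j / 2) = A"
    using assms by (auto simp: edge_part_def vec_eq_iff insert_commute field_simps)
qed

text \<open>
  A matrix of \<open>graph_matrices G\<close> must not vanish on any edge, but its span loses this
  condition: a symmetric matrix \<open>A\<close> supported on \<open>G\<close> is the difference of \<open>A + K\<close> and \<open>K\<close>,
  where the entries of \<open>K\<close> on the edges are too large for \<open>A\<close> to cancel.
\<close>

lemma span_graph_matrices:
  "span (graph_matrices G) = {A \<in> symm. \<forall>i j. i \<noteq> j \<longrightarrow> {i, j} \<notin> G \<longrightarrow> A $ i $ j = 0}"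
    (is "_ = ?V")
proof (intro equalityI subsetI)
  have "subspace ?V"
    by (auto simp: subspace_def symm_iff)
  moreover have "graph_matrices G \<subseteq> ?V"
    by (auto simp: graph_matrices_def)
  ultimately show "A \<in> ?V" if "A \<in> span (graph_matrices G)" for A
    using that span_minimal by blast
next
  fix A assume A: "A \<in> ?V"
  define K where "K = (\<chi> i j. if {i, j} \<in> G then norm A + 1 else 0)"
  have "A $ i $ j + (norm A + 1) > 0" for i j
    using component_le_norm_cart[of "A $ i" j] Finite_Cartesian_Product.norm_nth_le[of A i] by linarith
  then have "A $ i $ j + (norm A + 1) \<noteq> 0" for i j
    by (metis less_irrefl)
  moreover have "norm A + 1 \<noteq> 0"
    by (metis add_nonneg_eq_0_iff norm_ge_zero zero_le_one zero_neq_one)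
  ultimately have "A + K \<in> graph_matrices G" "K \<in> graph_matrices G"
    using A by (auto simp: graph_matrices_def symm_iff K_def insert_commute)
  then have "(A + K) - K \<in> span (graph_matrices G)"
    by (intro span_diff span_base)
  then show "A \<in> span (graph_matrices G)" by simp
qed

section \<open>The SSSP as surjectivity of a linear map\<close>

abbreviation hamiltonian_of :: "('p::finite) mat2 \<Rightarrow> 'p mat2" where
  "hamiltonian_of Z \<equiv> Omega ** (Z + transpose Z)"

lemma linear_hamiltonian_of: "linear hamiltonian_of"
  by (intro linearI) (simp_all add: matrix_algebra algebra_simps)

text \<open>
  The symmetric part of \<open>C\<close> is provided by the SSSP, and the skew-symmetric part is absorbed
  by \<open>edge_part\<close>.
\<close>

lemma SSSP_imp_onto:
  assumes "SSSP N"
  shows "\<exists>Z B. N ** hamiltonian_of Z + transpose (hamiltonian_of Z) ** N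
    + edge_part (graph_of N) B = C"
proof -
  define Cs Ck where "Cs = (1/2) *\<^sub>R (C + transpose C)" and "Ck = (1/2) *\<^sub>R (C - transpose C)"
  have "Cs \<in> symm"
    by (simp add: Cs_def symm_iff transpose_def add.commute)
  then have "Cs \<in> {N ** M + transpose M ** N | M. M \<in> hamiltonian}
      + span (graph_matrices (graph_of N))"
    using assms by (simp add: SSSP_def)
  then obtain M A where M: "M \<in> hamiltonian" and A: "A \<in> span (graph_matrices (graph_of N))"
    and Cs: "Cs = N ** M + transpose M ** N + A"
    by (auto elim!: set_plus_elim)
  obtain Z where Z: "M = hamiltonian_of Z"
    using M hamiltonian_parametrization by blast
  have "Ck $ i $ j + Ck $ j $ i = 0" for i j
    by (simp add: Ck_def transpose_def flip: add_divide_distrib)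
  moreover have "A $ i $ j + A $ j $ i = 0" if "i \<noteq> j" "{i, j} \<notin> graph_of N" for i j
    using A that by (simp add: span_graph_matrices insert_commute)
  moreover have "(A + Ck) $ i $ j + (A + Ck) $ j $ i =
      (A $ i $ j + A $ j $ i) + (Ck $ i $ j + Ck $ j $ i)" for i j
    by simp
  ultimately have "(A + Ck) $ i $ j + (A + Ck) $ j $ i = 0"
    if "i \<noteq> j" "{i, j} \<notin> graph_of N" for i j
    using that by (simp only: add_0_right)
  then obtain B where B: "edge_part (graph_of N) B = A + Ck"
    using range_edge_part by blast
  have "Cs + Ck = C"
    by (simp add: Cs_def Ck_def vec_eq_iff transpose_def flip: add_divide_distrib)
  then have "N ** hamiltonian_of Z + transpose (hamiltonian_of Z) ** N
      + edge_part (graph_of N) B = C"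
    using B Cs Z by (simp add: add.assoc)
  then show ?thesis by blast
qed

text \<open>
  A converse that also allows \<open>G\<close> to be smaller than the graph of \<open>N\<close>: this is what the
  matrix with inserted edges will satisfy. If \<open>C\<close> is symmetric, then so is the part of it that
  comes from \<open>edge_part\<close>, and it is thus supported on \<open>G\<close>.
\<close>

lemma SSSP_if_onto:
  assumes N: "N \<in> symm" and "G \<subseteq> graph_of N"
    and onto: "\<And>C. \<exists>Z B. N ** hamiltonian_of Z + transpose (hamiltonian_of Z) ** N
      + edge_part G B = C"
  shows "SSSP N"
  unfolding SSSP_def
proof (intro equalityI subsetI)
  fix C assume "C \<in> {N ** M + transpose M ** N | M. M \<in> hamiltonian}
      + span (graph_matrices (graph_of N))"
  then obtain M A where "A \<in> span (graph_matrices (graph_of N))"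
    and C: "C = N ** M + transpose M ** N + A"
    by (auto elim!: set_plus_elim)
  then have "A \<in> symm" by (simp add: span_graph_matrices)
  then show "C \<in> symm"
    using N unfolding C by (simp add: symm_def transpose_linear matrix_transpose_mul add.commute)
next
  fix C :: "'a mat2" assume C: "C \<in> symm"
  obtain Z B where ZB: "N ** hamiltonian_of Z + transpose (hamiltonian_of Z) ** N
      + edge_part G B = C"
    using onto by blast
  let ?T = "N ** hamiltonian_of Z + transpose (hamiltonian_of Z) ** N"
  have "?T \<in> symm"
    using N by (simp add: symm_def transpose_linear matrix_transpose_mul add.commute)
  moreover have B: "edge_part G B = C - ?T"
    using ZB by (simp add: algebra_simps)
  ultimately have "edge_part G B \<in> symm"
    using C by (simp add: symm_def transpose_linear)
  then have "edge_part G B \<in> span (graph_matrices (graph_of N))"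
    using edge_part_symm_eq_0[of G B] assms(2) by (auto simp: span_graph_matrices)
  moreover have "hamiltonian_of Z \<in> hamiltonian"
    using hamiltonian_parametrization by blast
  ultimately show "C \<in> {N ** M + transpose M ** N | M. M \<in> hamiltonian}
      + span (graph_matrices (graph_of N))"
    unfolding ZB[symmetric] by (intro set_plus_intro) auto
qed

section \<open>Symplectic congruence\<close>

lemma symplectic_mult:
  assumes "symplectic S" "symplectic T"
  shows "symplectic (S ** T)"
proof -
  have "transpose (S ** T) ** Omega ** (S ** T) = transpose T ** (transpose S ** Omega ** S) ** T"
    by (simp add: matrix_transpose_mul matrix_mul_assoc)
  then show ?thesis
    using assms by (simp add: symplectic_def)
qed

lemma symplectic_inverse:
  assumes "symplectic S"
  obtains T where "symplectic T" "S ** T = mat 1" "T ** S = mat 1"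
proof -
  define T where "T = - (Omega ** transpose S ** Omega)"
  have "T ** S = - (Omega ** (transpose S ** Omega ** S))"
    by (simp add: T_def matrix_algebra)
  then have TS: "T ** S = mat 1"
    using assms by (simp add: symplectic_def Omega_square)
  then have ST: "S ** T = mat 1"
    by (simp add: matrix_left_right_inverse)
  have "transpose T ** Omega ** T = transpose (S ** T) ** Omega ** (S ** T)"
    using assms by (simp add: symplectic_def matrix_transpose_mul matrix_mul_assoc)
       (metis matrix_mul_assoc)
  then have "symplectic T"
    by (simp add: symplectic_def ST)
  with ST TS show thesis by (intro that)
qed

text \<open>
  If \<open>R\<close> diagonalizes one of the two matrices, then \<open>S R\<close> or \<open>S\<^sup>-\<^sup>1 R\<close> diagonalizes the
  other, to the same diagonal matrix. The two definite descriptions therefore have equivalent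
  defining predicates.
\<close>

lemma symplectic_eigenvalues_congruence:
  assumes "symplectic S"
  shows "symplectic_eigenvalues (transpose S ** N ** S) = symplectic_eigenvalues N"
proof -
  obtain T where T: "symplectic T" "S ** T = mat 1"
    using symplectic_inverse[OF assms] by blast
  have "(\<exists>R. symplectic R \<and> transpose R ** (transpose S ** N ** S) ** R = D) \<longleftrightarrow>
      (\<exists>R. symplectic R \<and> transpose R ** N ** R = D)" for D
  proof safe
    fix R :: "'a mat2" assume "symplectic R"
    then show "\<exists>R'. symplectic R' \<and>
        transpose R' ** N ** R' = transpose R ** (transpose S ** N ** S) ** R"
      using assms by (intro exI[of _ "S ** R"])
        (simp add: symplectic_mult matrix_transpose_mul matrix_mul_assoc)
  next
    fix R :: "'a mat2" assume R: "symplectic R"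
    have "S ** (T ** R) = R"
      by (simp add: matrix_mul_assoc T)
    then have "transpose (T ** R) ** (transpose S ** N ** S) ** (T ** R) = transpose R ** N ** R"
      by (metis matrix_mul_assoc matrix_transpose_mul)
    then show "\<exists>R'. symplectic R' \<and>
        transpose R' ** (transpose S ** N ** S) ** R' = transpose R ** N ** R"
      using R T by (blast intro: symplectic_mult)
  qed
  then have "(\<exists>R d. symplectic R \<and> (\<forall>i. d i > 0) \<and>
        transpose R ** (transpose S ** N ** S) ** R = block (diag d) 0 0 (diag d) \<and>
        X = image_mset d (mset_set UNIV)) \<longleftrightarrow>
      (\<exists>R d. symplectic R \<and> (\<forall>i. d i > 0) \<and>
        transpose R ** N ** R = block (diag d) 0 0 (diag d) \<and>
        X = image_mset d (mset_set UNIV))" for X :: "real multiset"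
    by blast
  then show ?thesis
    unfolding symplectic_eigenvalues_def by simp
qed

lemma quadratic_form_congruence:
  "x \<bullet> ((transpose S ** N ** S) *v x) = (S *v x) \<bullet> (N *v (S *v x))"
  for x :: "real^'n" and N :: "real^'m^'m"
  by (metis dot_lmul_matrix inner_commute matrix_vector_mul_assoc transpose_matrix_vector)

lemma pos_def_congruence:
  assumes "pos_def N" "T ** S = mat 1"
  shows "pos_def (transpose S ** N ** S)"
proof -
  have "S *v x \<noteq> 0" if "x \<noteq> 0" for x
    using assms(2) that
    by (metis matrix_vector_mul_assoc matrix_vector_mul_lid matrix_vector_mult_0_right)
  then show ?thesis
    using assms(1)
    by (simp add: pos_def_def quadratic_form_congruence symm_def matrix_transpose_mul matrix_mul_assoc)
qed

text \<open>
  The inverse of \<open>1 - M\<close> exists because the equation forces it: if \<open>(1 - M) x = 0\<close>, then the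
  equation gives the vector \<open>(1 + M) x\<close> the value \<open>0\<close> under the positive definite form \<open>N\<close>, so
  \<open>M x = x\<close> and \<open>M x = -x\<close>. That \<open>S = (1 + M) (1 - M)\<^sup>-\<^sup>1\<close> is symplectic is the same
  equation with \<open>\<Omega>\<close> in place of \<open>N\<close> and of \<open>N'\<close>, and it holds as \<open>M\<^sup>T \<Omega> = - \<Omega> M\<close>.
\<close>

lemma cayley_transform:
  assumes N: "pos_def N" and M: "M \<in> hamiltonian"
    and eq: "transpose (mat 1 + M) ** N ** (mat 1 + M) = transpose (mat 1 - M) ** N' ** (mat 1 - M)"
  obtains S where "symplectic S" "N' = transpose S ** N ** S"
proof -
  have "x = 0" if x: "(mat 1 - M) *v x = 0" for x
  proof -
    have "((mat 1 + M) *v x) \<bullet> (N *v ((mat 1 + M) *v x)) = 0"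
      unfolding quadratic_form_congruence[symmetric] eq
      unfolding quadratic_form_congruence x by simp
    then have "(mat 1 + M) *v x = 0"
      using N unfolding pos_def_def by (metis less_irrefl)
    with x have "x - M *v x = 0" "x + M *v x = 0"
      by (simp_all add: matrix_vector_mult_diff_rdistrib matrix_vector_mult_add_rdistrib)
    then have "x + x = 0" by (metis add_diff_cancel_left' add.right_neutral eq_iff_diff_eq_0)
    then show "x = 0" by (simp flip: scaleR_2)
  qed
  then obtain B where "B ** (mat 1 - M) = mat 1"
    using matrix_left_invertible_ker by metis
  then have B: "(mat 1 - M) ** B = mat 1"
    by (simp add: matrix_left_right_inverse)
  define S where "S = (mat 1 + M) ** B"
  have conj: "transpose S ** X ** S = Y"
    if "transpose (mat 1 + M) ** X ** (mat 1 + M) = transpose (mat 1 - M) ** Y ** (mat 1 - M)" for X Y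
  proof -
    have "transpose S ** X ** S = transpose B ** (transpose (mat 1 + M) ** X ** (mat 1 + M)) ** B"
      by (simp add: S_def matrix_transpose_mul matrix_mul_assoc)
    also have "\<dots> = transpose ((mat 1 - M) ** B) ** Y ** ((mat 1 - M) ** B)"
      unfolding that by (simp add: matrix_transpose_mul matrix_mul_assoc)
    finally show ?thesis by (simp add: B)
  qed
  have "transpose M ** Omega = - (Omega ** M)"
    using M by (simp add: hamiltonian_iff symm_def matrix_transpose_mul transpose_Omega matrix_algebra)
      (metis minus_minus)
  then have "transpose (mat 1 + M) ** Omega ** (mat 1 + M) =
      transpose (mat 1 - M) ** Omega ** (mat 1 - M)"
    by (simp add: matrix_algebra algebra_simps)
  then have "symplectic S"
    unfolding symplectic_def by (rule conj)
  moreover have "N' = transpose S ** N ** S"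
    using conj[OF eq] by simp
  ultimately show thesis by (rule that)
qed

section \<open>Inserting edges\<close>

lemma graph_of_iff:
  assumes "N \<in> symm"
  shows "{i, j} \<in> graph_of N \<longleftrightarrow> i \<noteq> j \<and> N $ i $ j \<noteq> 0"
  using assms by (auto simp: graph_of_def doubleton_eq_iff symm_iff)

lemma graph_eqI:
  assumes "labeled_graph H" "\<And>i j. i \<noteq> j \<Longrightarrow> N $ i $ j \<noteq> 0 \<longleftrightarrow> {i, j} \<in> H"
  shows "graph_of N = H"
  using assms by (fastforce simp: graph_of_def labeled_graph_def card_2_iff)

lemma nonzero_entries_bounded_below:
  fixes N :: "real^'n^'m"
  obtains \<epsilon> where "\<epsilon> > 0" "\<And>i j. N $ i $ j \<noteq> 0 \<Longrightarrow> \<epsilon> \<le> \<bar>N $ i $ j\<bar>"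
proof
  let ?E = "insert 1 ((\<lambda>(i, j). \<bar>N $ i $ j\<bar>) ` {(i, j). N $ i $ j \<noteq> 0})"
  show "Min ?E > 0" by auto
  show "Min ?E \<le> \<bar>N $ i $ j\<bar>" if "N $ i $ j \<noteq> 0" for i j
    using that by (intro Min_le) force+
qed

theorem theorem3p15:
  fixes N :: "real ^ ('p::finite + 'p) ^ ('p + 'p)"
    and H :: "('p + 'p) set set"
  assumes "pos_def N"
    and "SSSP N"
    and "labeled_graph H"
    and "graph_of N \<subseteq> H"
  shows "\<exists>N' :: real ^ ('p + 'p) ^ ('p + 'p).
    pos_def N' \<and> graph_of N' = H \<and>
    symplectic_eigenvalues N' = symplectic_eigenvalues N \<and> SSSP N'"
proof -
  let ?G = "graph_of N"
  note onto = SSSP_imp_onto[OF assms(2)]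
  have N: "N \<in> symm" using assms(1) by (simp add: pos_def_def)
  obtain d1 where d1: "d1 > 0" "\<And>N' C. norm (N' - N) < d1 \<Longrightarrow> \<exists>Z B.
      N' ** hamiltonian_of Z + transpose (hamiltonian_of Z) ** N' + edge_part ?G B = C"
    using surjective_under_perturbation[OF linear_hamiltonian_of linear_edge_part onto] by metis
  obtain d2 where d2: "d2 > 0" "\<And>i j. N $ i $ j \<noteq> 0 \<Longrightarrow> d2 \<le> \<bar>N $ i $ j\<bar>"
    using nonzero_entries_bounded_below by blast
  define \<delta> where "\<delta> = min d1 d2"
  have "\<delta> > 0" using d1 d2 by (simp add: \<delta>_def)
  obtain K where K: "K > 0" "\<And>B. norm (edge_part ?G B) \<le> K * norm B"
    using linear_bounded_pos[OF linear_edge_part] by blast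
  have "\<delta> / (2 * K) > 0" using \<open>\<delta> > 0\<close> K by simp
  then obtain r where r: "r > 0" "\<And>Y. norm Y < r \<Longrightarrow> \<exists>Z B. norm B < \<delta> / (2 * K) \<and>
      transpose (mat 1 + hamiltonian_of Z) ** N ** (mat 1 + hamiltonian_of Z) =
      transpose (mat 1 - hamiltonian_of Z) ** (N + Y + edge_part ?G B) ** (mat 1 - hamiltonian_of Z)"
    using cayley_equation_solvable[OF linear_hamiltonian_of linear_edge_part _ onto] by metis
  (* The direction of the perturbation: one common new value at all inserted edges. *)
  define X :: "real ^ ('p + 'p) ^ ('p + 'p)" where
    "X = (\<chi> i j. if {i, j} \<in> H - ?G then 1 else 0)"
  define t where "t = min r (\<delta> / 2) / (norm X + 1)"
  have "norm X + 1 > 0" by (simp add: add_nonneg_pos)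
  then have "t > 0" "t * (norm X + 1) = min r (\<delta> / 2)"
    using r \<open>\<delta> > 0\<close> by (simp_all add: t_def)
  then have tX: "norm (t *\<^sub>R X) < r" "norm (t *\<^sub>R X) < \<delta> / 2"
    by (simp_all add: algebra_simps)
  obtain Z B where B: "norm B < \<delta> / (2 * K)"
    and eq: "transpose (mat 1 + hamiltonian_of Z) ** N ** (mat 1 + hamiltonian_of Z) =
      transpose (mat 1 - hamiltonian_of Z) ** (N + t *\<^sub>R X + edge_part ?G B)
        ** (mat 1 - hamiltonian_of Z)"
    using r(2)[OF tX(1)] by blast
  define N' where "N' = N + t *\<^sub>R X + edge_part ?G B"
  have "hamiltonian_of Z \<in> hamiltonian"
    using hamiltonian_parametrization by blast
  then obtain S where S: "symplectic S" "N' = transpose S ** N ** S"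
    using cayley_transform[OF assms(1) _ eq[folded N'_def]] by blast
  obtain T where "T ** S = mat 1"
    using symplectic_inverse[OF S(1)] by blast
  then have pd: "pos_def N'"
    unfolding S(2) by (rule pos_def_congruence[OF assms(1)])
  then have N': "N' \<in> symm" by (simp add: pos_def_def)
  have "K * norm B < \<delta> / 2"
    using B K by (simp add: field_simps)
  then have close: "norm (N' - N) < \<delta>"
    using K(2)[of B] tX(2) norm_triangle_ineq[of "t *\<^sub>R X" "edge_part ?G B"]
    by (simp add: N'_def)
  have "X \<in> symm" by (simp add: symm_iff X_def insert_commute)
  moreover have "edge_part ?G B = N' - N - t *\<^sub>R X" by (simp add: N'_def)
  ultimately have sym: "edge_part ?G B \<in> symm"
    using N N' by (simp add: symm_def transpose_linear)
  (* Old edges survive as N' is close to N; elsewhere the symmetric correction vanishes, so that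
     t * X decides. *)
  have "graph_of N' = H"
  proof (rule graph_eqI[OF assms(3)])
    fix i j :: "'p + 'p" assume "i \<noteq> j"
    show "N' $ i $ j \<noteq> 0 \<longleftrightarrow> {i, j} \<in> H"
    proof (cases "{i, j} \<in> ?G")
      case True
      then have "d2 \<le> \<bar>N $ i $ j\<bar>" using d2(2) N by (simp add: graph_of_iff)
      moreover have "\<bar>(N' - N) $ i $ j\<bar> < d2"
        using close component_le_norm_cart[of "(N' - N) $ i" j] 
          Finite_Cartesian_Product.norm_nth_le[of "N' - N" i]
        by (simp add: \<delta>_def)
      ultimately show ?thesis using True assms(4) by auto
    next
      case False
      then have "N $ i $ j = 0" "edge_part ?G B $ i $ j = 0"
        using \<open>i \<noteq> j\<close> N edge_part_symm_eq_0[OF sym] by (auto simp: graph_of_iff)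
      then have "N' $ i $ j = t * X $ i $ j" by (simp add: N'_def)
      then show ?thesis using False \<open>t > 0\<close> by (simp add: X_def)
    qed
  qed
  moreover have "SSSP N'"
    using N' assms(4) \<open>graph_of N' = H\<close> close
    by (intro SSSP_if_onto[of N' ?G] d1(2)) (auto simp: \<delta>_def)
  moreover have "symplectic_eigenvalues N' = symplectic_eigenvalues N"
    unfolding S(2) by (rule symplectic_eigenvalues_congruence[OF S(1)])
  ultimately show ?thesis using pd by blast
qed

end
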